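(* For every monotone measure $\mu$ on $(X,\mathcal{A})$, every measurable $f\colon X\to Y$ and every $n\ge 1$, $$\mathrm{I}_n^{+,\wedge}(\mu,f)=\mathrm{Su}_{+}^{n}(\mu,f).$$
   Context: $(X,\mathcal{A})$ is a measurable space with $X\neq\emptyset$ ($\mathcal{A}$ a $\sigma$-algebra), and $Y=[0,\bar y]$ with $0<\bar y\le\infty$. Notation: $a\wedge b=\min(a,b)$, $\{f\ge t\}=\{x\in X: f(x)\ge t\}$, and $\mathbb{1}_A$ is the indicator function of $A$. A monotone measure on $(X,\mathcal{A})$ is a set function $\mu\colon\mathcal{A}\to[0,\infty]$ with $\mu(A)\le\mu(B)$ whenever $A\subset B$, $\mu(\emptyset)=0$ and $\mu(X)>0$. The pseudo-decomposition integral of $n$-th order (Benvenuti integral of $n$-th order) with respect to the operations $\oplus=+$ and $\odot=\wedge$ is $$\mathrm{I}_n^{+,\wedge}(\mu,f)=\sup\Big\{\sum_{i=1}^n (a_i\wedge\mu(A_i)) : \sum_{i=1}^n a_i\mathbb{1}_{A_i}\le f,\ a_i\in Y,\ A_i\in\mathcal{A},\ A_1\subset\ldots\subset A_n\Big\}.$$ The lower $n$-Sugeno integral for the link map $+$ is defined recursively by $$\mathrm{Su}_{+}^{1}(\mu,f)=\sup_{t\in Y}\{t\wedge\mu(\{f\ge t\})\},\qquad \mathrm{Su}_{+}^{n+1}(\mu,f)=\sup_{t\in Y}\big\{t\wedge\big(\mu(\{f\ge t\})+\mathrm{Su}_{+}^{n}(\mu,f)\big)\big\}.$$ *)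

theory Defs
  imports "HOL-Analysis.Analysis"
begin

text \<open>
  A measurable space is represented by a value \<open>M :: 'a measure\<close> of which only \<^const>\<open>space\<close> and
  \<^const>\<open>sets\<close> are used; the \<open>\<sigma>\<close>-additive measure carried by \<open>M\<close> plays no role.
  The scale \<open>Y = [0, y]\<close> is the interval \<open>{0..y}\<close> of extended nonnegative reals, where \<open>y = \<infinity>\<close> is
  allowed.
\<close>

definition monotone_measure :: "'a measure \<Rightarrow> ('a set \<Rightarrow> ennreal) \<Rightarrow> bool" where
  "monotone_measure M \<mu> \<longleftrightarrow>
     (\<forall>A\<in>sets M. \<forall>B\<in>sets M. A \<subseteq> B \<longrightarrow> \<mu> A \<le> \<mu> B) \<and> \<mu> {} = 0 \<and> \<mu> (space M) > 0"

definition level_set :: "'a measure \<Rightarrow> ('a \<Rightarrow> ennreal) \<Rightarrow> ennreal \<Rightarrow> 'a set" where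
  "level_set M f t = {x \<in> space M. f x \<ge> t}"

text \<open>
  The pseudo-decomposition integral of order \<open>n\<close> for \<open>+\<close> and \<open>\<and>\<close>. The inclusions in the chain need
  not be strict. In the product \<open>a i * indicator (A i) x\<close> the convention \<open>\<infinity> * 0 = 0\<close> of \<^typ>\<open>ennreal\<close>
  applies.
\<close>

definition pseudo_decomposition_integral ::
    "ennreal \<Rightarrow> 'a measure \<Rightarrow> nat \<Rightarrow> ('a set \<Rightarrow> ennreal) \<Rightarrow> ('a \<Rightarrow> ennreal) \<Rightarrow> ennreal" where
  "pseudo_decomposition_integral y M n \<mu> f =
     Sup {(\<Sum>i=1..n. min (a i) (\<mu> (A i))) | (a :: nat \<Rightarrow> ennreal) (A :: nat \<Rightarrow> 'a set).
       (\<forall>x\<in>space M. (\<Sum>i=1..n. a i * indicator (A i) x) \<le> f x) \<and>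
       (\<forall>i\<in>{1..n}. a i \<in> {0..y}) \<and>
       (\<forall>i\<in>{1..n}. A i \<in> sets M) \<and>
       (\<forall>i\<in>{1..<n}. A i \<subseteq> A (Suc i))}"

text \<open>
  The lower \<open>n\<close>-Sugeno integral for the link map \<open>+\<close> is defined for \<open>n \<ge> 1\<close>; its value at \<open>n = 0\<close> is a
  dummy that the other equations do not refer to.
\<close>

fun lower_sugeno ::
    "ennreal \<Rightarrow> 'a measure \<Rightarrow> nat \<Rightarrow> ('a set \<Rightarrow> ennreal) \<Rightarrow> ('a \<Rightarrow> ennreal) \<Rightarrow> ennreal" where
  "lower_sugeno y M 0 \<mu> f = 0"
| "lower_sugeno y M (Suc 0) \<mu> f = (SUP t\<in>{0..y}. min t (\<mu> (level_set M f t)))"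
| "lower_sugeno y M (Suc (Suc n)) \<mu> f =
     (SUP t\<in>{0..y}. min t (\<mu> (level_set M f t) + lower_sugeno y M (Suc n) \<mu> f))"

end

theory Submission
  imports Defs
begin

text \<open>
  A family \<open>a\<^sub>1 1\<^bsub>A\<^sub>1\<^esub> + \<dots> + a\<^sub>n 1\<^bsub>A\<^sub>n\<^esub> \<le> f\<close> over a
  chain has the value \<open>a\<^sub>1 + \<dots> + a\<^sub>n\<close> on \<open>A\<^sub>1\<close>, so \<open>A\<^sub>1\<close> lies in the level set of \<open>f\<close> at this height,
  while the remaining \<open>n - 1\<close> terms are again such a family. One step of the Sugeno recursion taken at
  the height \<open>t = a\<^sub>1 + \<dots> + a\<^sub>n\<close> therefore dominates the contribution of the smallest set \<open>A\<^sub>1\<close>; an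
  empty \<open>A\<^sub>1\<close> contributes nothing, and then the Sugeno integrals increase with the order. Hence
  induction gives that the decomposition integral is at most the Sugeno integral
  (\<open>decomposition_value_le_lower_sugeno\<close>).

  Conversely, the Sugeno recursion can be read as climbing from \<open>0\<close>: from a height \<open>s\<close> one may climb by any
  \<open>d\<close> with \<open>d \<le> \<mu> {f \<ge> s + d}\<close>. Putting a new smallest set \<open>{f \<ge> s + d}\<close> with coefficient \<open>d\<close> in
  front of the chain keeps the family below \<open>f\<close>, and all increments survive the truncation by \<open>\<mu>\<close>, so
  the value of the family is exactly the height (\<open>saturated_extend\<close>). The supremum of the heights that
  can be climbed in \<open>n\<close> steps is at least the \<open>n\<close>-th Sugeno integral
  (\<open>lower_sugeno_le_Sup_saturated\<close>), because addition of a constant and truncation commute with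
  suprema in \<open>[0, \<infinity>]\<close>.
\<close>

definition chain_below ::
    "ennreal \<Rightarrow> 'a measure \<Rightarrow> nat \<Rightarrow> ('a \<Rightarrow> ennreal) \<Rightarrow> (nat \<Rightarrow> ennreal) \<Rightarrow> (nat \<Rightarrow> 'a set) \<Rightarrow> bool" where
  "chain_below y M n f a A \<longleftrightarrow>
     (\<forall>x\<in>space M. (\<Sum>i=1..n. a i * indicator (A i) x) \<le> f x) \<and>
     (\<forall>i\<in>{1..n}. a i \<in> {0..y}) \<and>
     (\<forall>i\<in>{1..n}. A i \<in> sets M) \<and>
     (\<forall>i\<in>{1..<n}. A i \<subseteq> A (Suc i))"

text \<open>
  The number \<open>s\<close> is the value of a family that loses nothing under truncation by \<open>\<mu>\<close>. The condition
  that the chain contains the level set at height \<open>s\<close> is what allows a higher level set to be put in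
  front of it.
\<close>

definition saturated ::
    "ennreal \<Rightarrow> 'a measure \<Rightarrow> nat \<Rightarrow> ('a set \<Rightarrow> ennreal) \<Rightarrow> ('a \<Rightarrow> ennreal) \<Rightarrow> ennreal \<Rightarrow> bool" where
  "saturated y M n \<mu> f s \<longleftrightarrow>
     (\<exists>a A. chain_below y M n f a A \<and> (\<Sum>i=1..n. a i) = s \<and>
        (\<forall>i\<in>{1..n}. a i \<le> \<mu> (A i) \<and> level_set M f s \<subseteq> A i))"

lemma sum_head_shift:
  fixes g :: "nat \<Rightarrow> 'b::comm_monoid_add"
  shows "(\<Sum>i=1..Suc n. g i) = g 1 + (\<Sum>i=1..n. g (Suc i))"
  by (simp add: sum.atLeast_Suc_atMost sum.shift_bounds_cl_Suc_ivl del: sum.cl_ivl_Suc)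

lemma ball_head_shift:
  "(\<forall>i\<in>{1..Suc n}. P i) \<longleftrightarrow> P 1 \<and> (\<forall>i\<in>{1..n}. P (Suc i))"
proof -
  have "{1..Suc n} = insert 1 (Suc ` {1..n})"
    by (auto simp: image_Suc_atLeastAtMost)
  then show ?thesis by (simp only: ball_simps)
qed

lemma level_set_antimono: "s \<le> t \<Longrightarrow> level_set M f t \<subseteq> level_set M f s"
  by (auto simp: level_set_def)

lemma level_set_sets:
  assumes "f \<in> borel_measurable M"
  shows "level_set M f t \<in> sets M"
  unfolding level_set_def using assms by measurable

text \<open>
  The recursion of the Sugeno integral starts at order \<open>1\<close>, but its first instance is the general one
  for the dummy value \<open>0\<close> at order \<open>0\<close>.
\<close>

lemma lower_sugeno_Suc:
  "lower_sugeno y M (Suc n) \<mu> f = (SUP t\<in>{0..y}. min t (\<mu> (level_set M f t) + lower_sugeno y M n \<mu> f))"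
  by (cases n) simp_all

lemma lower_sugeno_le: "lower_sugeno y M n \<mu> f \<le> y"
  by (cases n) (auto simp: lower_sugeno_Suc simp del: lower_sugeno.simps(2,3)
      intro!: SUP_least min.coboundedI1)

lemma lower_sugeno_le_Suc: "lower_sugeno y M n \<mu> f \<le> lower_sugeno y M (Suc n) \<mu> f"
  unfolding lower_sugeno_Suc
  \<comment> \<open>The choice \<open>t = lower_sugeno y M n \<mu> f\<close> reproduces the old value.\<close>
  by (rule SUP_upper2[where i = "lower_sugeno y M n \<mu> f"]) (auto simp: lower_sugeno_le)

lemma chain_below_mono:
  assumes "chain_below y M n f a A" and "1 \<le> i" and "i \<le> j" and "j \<le> n"
  shows "A i \<subseteq> A j"
  using assms(3,4)
proof (induction j rule: dec_induct)
  case (step j)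
  then have "A j \<subseteq> A (Suc j)"
    using assms(1,2) by (auto simp: chain_below_def)
  then show ?case using step by auto
qed simp

lemma chain_below_tail:
  assumes "chain_below y M (Suc n) f a A"
  shows "chain_below y M n f (\<lambda>i. a (Suc i)) (\<lambda>i. A (Suc i))"
proof -
  have "(\<Sum>i=1..n. a (Suc i) * indicator (A (Suc i)) x) \<le> f x" if "x \<in> space M" for x
  proof -
    have "(\<Sum>i=1..n. a (Suc i) * indicator (A (Suc i)) x) \<le> (\<Sum>i=1..Suc n. a i * indicator (A i) x)"
      unfolding sum_head_shift by simp
    also have "\<dots> \<le> f x"
      using assms that unfolding chain_below_def by blast
    finally show ?thesis .
  qed
  then show ?thesis
    using assms unfolding chain_below_def by auto
qed

text \<open>Every set of the chain contains the smallest one, so on \<open>A 1\<close> no summand vanishes.\<close>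

lemma chain_below_sum_le:
  assumes "chain_below y M n f a A" and "x \<in> A 1" and "x \<in> space M"
  shows "(\<Sum>i=1..n. a i) \<le> f x"
proof -
  have "x \<in> A i" if "i \<in> {1..n}" for i
    using chain_below_mono[OF assms(1), of 1 i] assms(2) that by auto
  then have "(\<Sum>i=1..n. a i) = (\<Sum>i=1..n. a i * indicator (A i) x)"
    by (intro sum.cong) auto
  also have "\<dots> \<le> f x"
    using assms(1,3) unfolding chain_below_def by blast
  finally show ?thesis .
qed

lemma decomposition_value_le_lower_sugeno:
  assumes mono: "monotone_measure M \<mu>" and meas: "f \<in> borel_measurable M"
    and le_y: "\<And>x. x \<in> space M \<Longrightarrow> f x \<le> y"
    and "chain_below y M n f a A"
  shows "(\<Sum>i=1..n. min (a i) (\<mu> (A i))) \<le> lower_sugeno y M n \<mu> f"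
  using assms(4)
proof (induction n arbitrary: a A)
  case 0
  then show ?case by simp
next
  case (Suc n)
  let ?T = "\<Sum>i=1..n. min (a (Suc i)) (\<mu> (A (Suc i)))"
  let ?t = "\<Sum>i=1..Suc n. a i"
  have tail: "?T \<le> lower_sugeno y M n \<mu> f"
    using Suc.IH[OF chain_below_tail[OF Suc.prems]] .
  have A1: "A 1 \<in> sets M"
    using Suc.prems by (auto simp: chain_below_def)
  show ?case
  proof (cases "A 1 = {}")
    case True
    then have "(\<Sum>i=1..Suc n. min (a i) (\<mu> (A i))) = ?T"
      using mono unfolding sum_head_shift by (simp add: monotone_measure_def)
    then show ?thesis
      using tail lower_sugeno_le_Suc order_trans by metis
  next
    case False
    have sub: "A 1 \<subseteq> level_set M f ?t"
      using chain_below_sum_le[OF Suc.prems] sets.sets_into_space[OF A1]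
      by (auto simp: level_set_def)
    \<comment> \<open>A point of \<open>A 1\<close> witnesses that the height \<open>?t\<close> belongs to the scale.\<close>
    obtain x where "x \<in> space M" "?t \<le> f x"
      using False sub by (auto simp: level_set_def)
    then have "?t \<in> {0..y}"
      using le_y[of x] by auto
    moreover have "(\<Sum>i=1..Suc n. min (a i) (\<mu> (A i))) \<le> ?t"
      by (intro sum_mono) simp
    moreover have "\<mu> (A 1) \<le> \<mu> (level_set M f ?t)"
      using mono A1 level_set_sets[OF meas] sub unfolding monotone_measure_def by blast
    then have "(\<Sum>i=1..Suc n. min (a i) (\<mu> (A i))) \<le> \<mu> (level_set M f ?t) + lower_sugeno y M n \<mu> f"
      unfolding sum_head_shift[of "\<lambda>i. min (a i) (\<mu> (A i))"]
      by (intro add_mono tail) (simp add: min.coboundedI2)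
    ultimately show ?thesis
      unfolding lower_sugeno_Suc by (intro SUP_upper2[where i = ?t]) simp_all
  qed
qed

lemma saturated_0: "saturated y M 0 \<mu> f 0"
  by (simp add: saturated_def chain_below_def)

lemma saturated_extend:
  assumes meas: "f \<in> borel_measurable M"
    and sat: "saturated y M n \<mu> f s"
    and d: "d \<le> \<mu> (level_set M f (s + d))" and le: "s + d \<le> y"
  shows "saturated y M (Suc n) \<mu> f (s + d)"
proof -
  obtain a A where below: "chain_below y M n f a A" and sum: "(\<Sum>i=1..n. a i) = s"
    and a: "\<forall>i\<in>{1..n}. a i \<le> \<mu> (A i) \<and> level_set M f s \<subseteq> A i"
    using sat unfolding saturated_def by blast
  define a' where "a' i = (case i of Suc (Suc j) \<Rightarrow> a (Suc j) | _ \<Rightarrow> d)" for i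
  define A' where "A' i = (case i of Suc (Suc j) \<Rightarrow> A (Suc j) | _ \<Rightarrow> level_set M f (s + d))" for i
  have head: "a' 1 = d" "A' 1 = level_set M f (s + d)"
    by (simp_all add: a'_def A'_def)
  have tail: "a' (Suc i) = a i" "A' (Suc i) = A i" if "i \<in> {1..n}" for i
    using that by (cases i; simp add: a'_def A'_def)+
  have sub: "level_set M f (s + d) \<subseteq> A i" if "i \<in> {1..n}" for i
  proof -
    have "level_set M f (s + d) \<subseteq> level_set M f s"
      by (rule level_set_antimono) simp
    then show ?thesis using a that by blast
  qed
  have sum': "(\<Sum>i=1..Suc n. a' i) = s + d"
    unfolding sum_head_shift using sum head tail by (simp add: add.commute)
  have "(\<Sum>i=1..Suc n. a' i * indicator (A' i) x) \<le> f x" if x: "x \<in> space M" for x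
  proof (cases "x \<in> level_set M f (s + d)")
    case True
    have "(\<Sum>i=1..Suc n. a' i * indicator (A' i) x) \<le> (\<Sum>i=1..Suc n. a' i)"
      by (intro sum_mono) (simp add: indicator_def)
    also have "\<dots> \<le> f x"
      using True unfolding sum' by (simp add: level_set_def)
    finally show ?thesis .
  next
    case False
    then have "(\<Sum>i=1..Suc n. a' i * indicator (A' i) x) = (\<Sum>i=1..n. a i * indicator (A i) x)"
      unfolding sum_head_shift using head tail by simp
    also have "\<dots> \<le> f x"
      using below x unfolding chain_below_def by blast
    finally show ?thesis .
  qed
  moreover have "\<forall>i\<in>{1..Suc n}. a' i \<in> {0..y}"
    using below le head tail unfolding ball_head_shift chain_below_def
    by (auto intro: order_trans[OF _ le])
  moreover have "\<forall>i\<in>{1..Suc n}. A' i \<in> sets M"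
    using below level_set_sets[OF meas] head tail unfolding ball_head_shift chain_below_def
    by auto
  moreover have "A' i \<subseteq> A' (Suc i)" if i: "i \<in> {1..<Suc n}" for i
  proof (cases "i = 1")
    case True
    then show ?thesis using i head tail[of 1] sub[of 1] by auto
  next
    case False
    then obtain j where j: "i = Suc j" "j \<in> {1..<n}"
      using i by (cases i) auto
    then show ?thesis
      using below tail[of j] tail[of "Suc j"] by (auto simp: chain_below_def)
  qed
  ultimately have "chain_below y M (Suc n) f a' A'"
    unfolding chain_below_def by blast
  moreover have "\<forall>i\<in>{1..Suc n}. a' i \<le> \<mu> (A' i) \<and> level_set M f (s + d) \<subseteq> A' i"
    unfolding ball_head_shift using head tail d a sub by auto
  ultimately show ?thesis
    unfolding saturated_def using sum' by blast
qed

text \<open>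
  For a fixed \<open>t\<close> the truncated sum \<open>r = min t (\<mu> {f \<ge> t} + s)\<close> is either at most \<open>s\<close> already, or it
  is reached from \<open>s\<close> by the increment \<open>r - s \<le> \<mu> {f \<ge> t} \<le> \<mu> {f \<ge> r}\<close>.
\<close>

lemma lower_sugeno_le_Sup_saturated:
  assumes mono: "monotone_measure M \<mu>" and meas: "f \<in> borel_measurable M"
  shows "lower_sugeno y M n \<mu> f \<le> Sup {s. saturated y M n \<mu> f s \<and> s \<le> y}"
proof (induction n)
  case 0
  then show ?case by simp
next
  case (Suc n)
  let ?G = "\<lambda>n. {s. saturated y M n \<mu> f s \<and> s \<le> y}"
  have extend: "s + d \<in> ?G (Suc n)"
    if "s \<in> ?G n" "d \<le> \<mu> (level_set M f (s + d))" "s + d \<le> y" for s d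
    using saturated_extend[OF meas] that by auto
  have "saturated y M m \<mu> f 0" for m
    using saturated_extend[OF meas, where s = 0 and d = 0]
    by (induction m) (simp_all add: saturated_0)
  then have ne: "?G n \<noteq> {}" by force
  have bound: "min t (\<mu> (level_set M f t) + s) \<le> Sup (?G (Suc n))"
    if t: "t \<le> y" and s: "s \<in> ?G n" for t s
  proof -
    let ?r = "min t (\<mu> (level_set M f t) + s)"
    show ?thesis
    proof (cases "?r \<le> s")
      case True
      have "s \<in> ?G (Suc n)" using extend[OF s, of 0] s by simp
      then show ?thesis using True by (meson Sup_upper order_trans)
    next
      case False
      have r: "s + (?r - s) = ?r"
        using False by (intro add_diff_inverse_ennreal less_imp_le) (simp only: not_le)
      have "?r - s \<le> \<mu> (level_set M f t)"
        \<comment> \<open>Here \<open>s\<close> is finite because \<open>s < ?r\<close>; this makes the subtraction faithful.\<close>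
        using False by (auto simp: ennreal_minus_le_iff add.commute)
      also have "\<dots> \<le> \<mu> (level_set M f ?r)"
        using mono level_set_sets[OF meas] level_set_antimono[of ?r t M f]
        unfolding monotone_measure_def by simp
      finally have "?r \<in> ?G (Suc n)"
        using extend[OF s, of "?r - s"] t unfolding r by (simp add: min.coboundedI1)
      then show ?thesis by (rule Sup_upper)
    qed
  qed
  have "min t (\<mu> (level_set M f t) + lower_sugeno y M n \<mu> f) \<le> Sup (?G (Suc n))" if "t \<le> y" for t
  proof -
    have "min t (\<mu> (level_set M f t) + lower_sugeno y M n \<mu> f)
        \<le> min t (\<mu> (level_set M f t) + (SUP s\<in>?G n. s))"
      using Suc.IH by (intro min.mono add_left_mono order_refl) simp
    also have "\<dots> = (SUP s\<in>?G n. min t (\<mu> (level_set M f t) + s))"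
      unfolding ennreal_SUP_add_right[OF ne] by (simp only: inf_min[symmetric] inf_SUP)
    also have "\<dots> \<le> Sup (?G (Suc n))"
      using bound that by (intro SUP_least)
    finally show ?thesis .
  qed
  then show ?case
    unfolding lower_sugeno_Suc by (intro SUP_least) simp
qed

theorem theorem4p10:
  fixes M :: "'a measure"
    and y :: ennreal
    and \<mu> :: "'a set \<Rightarrow> ennreal"
    and f :: "'a \<Rightarrow> ennreal"
    and n :: nat
  assumes "space M \<noteq> {}"
    and "0 < y"
    and "monotone_measure M \<mu>"
    and "f \<in> M \<rightarrow>\<^sub>M restrict_space borel {0..y}"
    and "n \<ge> 1"
  shows "pseudo_decomposition_integral y M n \<mu> f = lower_sugeno y M n \<mu> f"
proof (rule antisym)
  have meas: "f \<in> borel_measurable M"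
    using assms(4) by (simp add: measurable_restrict_space2_iff)
  have le_y: "f x \<le> y" if "x \<in> space M" for x
    using measurable_space[OF assms(4) that] by (simp add: space_restrict_space)
  have integral_eq: "pseudo_decomposition_integral y M n \<mu> f =
      Sup {\<Sum>i=1..n. min (a i) (\<mu> (A i)) | a A. chain_below y M n f a A}"
    unfolding pseudo_decomposition_integral_def chain_below_def ..
  show "pseudo_decomposition_integral y M n \<mu> f \<le> lower_sugeno y M n \<mu> f"
    unfolding integral_eq
    using decomposition_value_le_lower_sugeno[OF assms(3) meas le_y]
    by (auto intro!: Sup_least)
  have "s \<le> pseudo_decomposition_integral y M n \<mu> f" if sat: "saturated y M n \<mu> f s" for s
  proof -
    obtain a A where below: "chain_below y M n f a A" and sum: "(\<Sum>i=1..n. a i) = s"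
      and le: "\<forall>i\<in>{1..n}. a i \<le> \<mu> (A i) \<and> level_set M f s \<subseteq> A i"
      using sat unfolding saturated_def by blast
    have "(\<Sum>i=1..n. a i) = (\<Sum>i=1..n. min (a i) (\<mu> (A i)))"
      using le by (intro sum.cong) (auto simp: min_absorb1)
    then have "s = (\<Sum>i=1..n. min (a i) (\<mu> (A i)))"
      using sum by metis
    then show ?thesis
      unfolding integral_eq using below by (intro Sup_upper) blast
  qed
  then have "Sup {s. saturated y M n \<mu> f s \<and> s \<le> y} \<le> pseudo_decomposition_integral y M n \<mu> f"
    by (auto intro: Sup_least)
  with lower_sugeno_le_Sup_saturated[OF assms(3) meas]
  show "lower_sugeno y M n \<mu> f \<le> pseudo_decomposition_integral y M n \<mu> f"
    by (rule order_trans)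
qed

end
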